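(* Let $T$ be any tree with maximum degree $\Delta(T)\ge 3$. Then $\chi_{3-vsdt}(T)\le 2\Delta(T)+1$.
   Context: All graphs are finite, simple and undirected. For a vertex $u$ of a graph $G$, let $N\langle u\rangle = N[u]\cup\{uv : v\in N(u)\}$, where $N(u)$ and $N[u]=N(u)\cup\{u\}$ are the open and closed neighborhoods; so $N\langle u\rangle$ consists of $u$, its neighbors and its incident edges. A proper $\kappa$-total coloring of $G$ is a map $f:V(G)\cup E(G)\to\{1,\dots,\kappa\}$ such that any two adjacent vertices, any two edges sharing an endpoint, and any vertex and incident edge receive different colors. Put $C_f\langle u\rangle=\{f(x): x\in N\langle u\rangle\}$. For a graph $G$ with no isolated edges (no connected component is $K_2$), a $\kappa$-$D(3)$-VSDTC of $G$ ($3$-vertex-strongly-distinguishing total coloring) is a proper $\kappa$-total coloring $f$ such that $C_f\langle u\rangle\neq C_f\langle v\rangle$ for any two distinct vertices $u,v$ at distance at most $3$. $\chi_{3-vsdt}(G)$ is the minimum $\kappa$ for which $G$ admits a $\kappa$-$D(3)$-VSDTC. *)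

theory Defs
  imports Main "HOL-Library.Extended_Nat"
begin

text \<open>A graph is given by its vertex set \<open>V\<close> and its set \<open>E\<close> of edges, which are
  two-element sets of vertices.\<close>

definition simple_graph :: "'a set \<Rightarrow> 'a set set \<Rightarrow> bool" where
  "simple_graph V E \<longleftrightarrow> finite V \<and> (\<forall>e\<in>E. e \<subseteq> V \<and> card e = 2)"

definition neighbors :: "'a set set \<Rightarrow> 'a \<Rightarrow> 'a set" where
  "neighbors E u = {v. {u, v} \<in> E}"

definition closed_neighbors :: "'a set set \<Rightarrow> 'a \<Rightarrow> 'a set" where
  "closed_neighbors E u = insert u (neighbors E u)"

definition degree :: "'a set set \<Rightarrow> 'a \<Rightarrow> nat" where
  "degree E u = card (neighbors E u)"

text \<open>Only meaningful for finite nonempty \<open>V\<close>.\<close>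

definition max_degree :: "'a set \<Rightarrow> 'a set set \<Rightarrow> nat" where
  "max_degree V E = Max (degree E ` V)"

text \<open>Paths and cycles are lists of distinct vertices; the closing edge of a cycle joins its
  last vertex to its first.\<close>

definition graph_path :: "'a set \<Rightarrow> 'a set set \<Rightarrow> 'a list \<Rightarrow> bool" where
  "graph_path V E p \<longleftrightarrow> p \<noteq> [] \<and> distinct p \<and> set p \<subseteq> V \<and> successively (\<lambda>x y. {x, y} \<in> E) p"

definition paths_between :: "'a set \<Rightarrow> 'a set set \<Rightarrow> 'a \<Rightarrow> 'a \<Rightarrow> 'a list set" where
  "paths_between V E u v = {p. graph_path V E p \<and> hd p = u \<and> last p = v}"

definition graph_cycle :: "'a set \<Rightarrow> 'a set set \<Rightarrow> 'a list \<Rightarrow> bool" where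
  "graph_cycle V E p \<longleftrightarrow> graph_path V E p \<and> length p \<ge> 3 \<and> {last p, hd p} \<in> E"

definition connected_graph :: "'a set \<Rightarrow> 'a set set \<Rightarrow> bool" where
  "connected_graph V E \<longleftrightarrow> V \<noteq> {} \<and> (\<forall>u\<in>V. \<forall>v\<in>V. paths_between V E u v \<noteq> {})"

definition tree_graph :: "'a set \<Rightarrow> 'a set set \<Rightarrow> bool" where
  "tree_graph V E \<longleftrightarrow> simple_graph V E \<and> connected_graph V E \<and> (\<nexists>p. graph_cycle V E p)"

text \<open>The length of a path is its number of edges. The distance is \<open>\<infinity>\<close> between different
  components.\<close>

definition graph_dist :: "'a set \<Rightarrow> 'a set set \<Rightarrow> 'a \<Rightarrow> 'a \<Rightarrow> enat" where
  "graph_dist V E u v = (INF p \<in> paths_between V E u v. enat (length p - 1))"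

text \<open>A total coloring lives on the disjoint union of vertices (\<open>Inl\<close>) and edges (\<open>Inr\<close>). Its
  values outside the graph are unconstrained and irrelevant.\<close>

definition proper_total_coloring ::
    "'a set \<Rightarrow> 'a set set \<Rightarrow> nat \<Rightarrow> ('a + 'a set \<Rightarrow> nat) \<Rightarrow> bool" where
  "proper_total_coloring V E k f \<longleftrightarrow>
     f ` (Inl ` V \<union> Inr ` E) \<subseteq> {1..k} \<and>
     (\<forall>u\<in>V. \<forall>v\<in>V. {u, v} \<in> E \<longrightarrow> f (Inl u) \<noteq> f (Inl v)) \<and>
     (\<forall>e\<in>E. \<forall>e'\<in>E. e \<noteq> e' \<and> e \<inter> e' \<noteq> {} \<longrightarrow> f (Inr e) \<noteq> f (Inr e')) \<and>
     (\<forall>e\<in>E. \<forall>v\<in>e. f (Inl v) \<noteq> f (Inr e))"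

text \<open>\<open>N\<langle>u\<rangle>\<close>, consisting of \<open>u\<close>, its neighbors and its incident edges, and \<open>C\<^sub>f\<langle>u\<rangle>\<close>.\<close>

definition total_neighborhood :: "'a set set \<Rightarrow> 'a \<Rightarrow> ('a + 'a set) set" where
  "total_neighborhood E u = Inl ` closed_neighbors E u \<union> Inr ` {{u, v} |v. v \<in> neighbors E u}"

definition color_set :: "'a set set \<Rightarrow> ('a + 'a set \<Rightarrow> nat) \<Rightarrow> 'a \<Rightarrow> nat set" where
  "color_set E f u = f ` total_neighborhood E u"

text \<open>The notion is intended for graphs without isolated edges. That restriction is not part
  of the definition: the two ends of an isolated edge have the same total neighborhood, so a
  graph with an isolated edge has no such coloring.\<close>

definition D3_VSDTC :: "'a set \<Rightarrow> 'a set set \<Rightarrow> nat \<Rightarrow> ('a + 'a set \<Rightarrow> nat) \<Rightarrow> bool" where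
  "D3_VSDTC V E k f \<longleftrightarrow> proper_total_coloring V E k f \<and>
     (\<forall>u\<in>V. \<forall>v\<in>V. u \<noteq> v \<and> graph_dist V E u v \<le> 3 \<longrightarrow> color_set E f u \<noteq> color_set E f v)"

text \<open>The minimum is taken in \<^typ>\<open>enat\<close>, so that it is \<open>\<infinity>\<close> (and not an unspecified number)
  when no coloring exists; a finite bound therefore entails that a coloring exists.\<close>

definition chi_3vsdt :: "'a set \<Rightarrow> 'a set set \<Rightarrow> enat" where
  "chi_3vsdt V E = (INF k \<in> {k. \<exists>f. D3_VSDTC V E k f}. enat k)"

end

theory Submission
  imports Defs
begin

text \<open>Root the tree at a vertex of maximum degree \<open>\<Delta>\<close> and color it top down, treating all children of
  a vertex at once. Suppose \<open>u\<close> has parent \<open>p\<close> and \<open>m \<ge> 1\<close> children. The colors of \<open>u\<close>, \<open>p\<close> and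
  \<open>up\<close> are already fixed, and for every set \<open>S\<close> of \<open>m\<close> or \<open>m + 1\<close> of the other \<open>2\<Delta> - 2\<close> colors the
  color set of \<open>u\<close> can be made these three colors together with \<open>S\<close>: the edges to the children use
  \<open>m\<close> colors of \<open>S\<close>, the children use the remaining colors of \<open>S\<close> and the color of \<open>up\<close>. There are
  \<open>(2\<Delta> - 1) choose (m + 1) \<ge> (2\<Delta> - 1)(\<Delta> - 1)\<close> such \<open>S\<close>, and at most
  \<open>\<Delta> + (\<Delta> - 1)\<^sup>2\<close> vertices treated before are within distance 3 of \<open>u\<close>, so some \<open>S\<close> avoids all
  of their color sets. Leaves have 3 colors and inner vertices at least 4. Two leaves are
  distinguished because the color of \<open>p\<close> is never used below \<open>u\<close>, and no child of \<open>u\<close> gets the color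
  of an edge from \<open>u\<close> to a child.\<close>

section \<open>Rooting a tree: parent and depth functions\<close>

lemma successively_crossing:
  assumes "successively R p" "p \<noteq> []" "hd p \<in> W" "last p \<notin> W"
  shows "\<exists>x y. R x y \<and> x \<in> W \<and> y \<notin> W"
  using assms
proof (induction p)
  case (Cons a p)
  show ?case
  proof (cases "p = []")
    case False
    then show ?thesis using Cons by (cases "hd p \<in> W") (auto simp: successively_Cons)
  qed (use Cons in auto)
qed simp

lemma graph_path_snoc:
  assumes "graph_path W E p" "{last p, y} \<in> E" "y \<notin> W"
  shows "graph_path (insert y W) E (p @ [y])"
  using assms by (auto simp: graph_path_def successively_append_iff)

lemma graph_path_Cons:
  assumes "graph_path W E p" "{hd p, y} \<in> E" "y \<notin> W"
  shows "graph_path (insert y W) E (y # p)"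
  using assms by (auto simp: graph_path_def successively_Cons insert_commute)

lemma graph_path_mono: "graph_path W E p \<Longrightarrow> W \<subseteq> V \<Longrightarrow> graph_path V E p"
  by (auto simp: graph_path_def)

text \<open>Induction on the number of vertices outside the subtree \<open>W\<close>. Connectivity
  yields an edge from some \<open>x\<close> in \<open>W\<close> to some \<open>y\<close> outside,
  and \<open>y\<close> is attached below \<open>x\<close>. Acyclicity makes \<open>xy\<close> the
  only edge from \<open>y\<close> into \<open>W\<close>, so the description of the edges
  survives.\<close>

lemma tree_parents_extend:
  assumes tree: "tree_graph V E"
    and "r \<in> W" "W \<subseteq> V"
    and "\<And>x y. x \<in> W \<Longrightarrow> y \<in> W \<Longrightarrow> \<exists>p. graph_path W E p \<and> hd p = x \<and> last p = y"
    and "\<And>v. v \<in> W - {r} \<Longrightarrow> par v \<in> W \<and> dep v = Suc (dep (par v))"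
    and "{e \<in> E. e \<subseteq> W} = {{v, par v} |v. v \<in> W - {r}}"
  shows "\<exists>par (dep :: 'a \<Rightarrow> nat). (\<forall>v\<in>V - {r}. par v \<in> V \<and> dep v = Suc (dep (par v))) \<and>
    E = {{v, par v} |v. v \<in> V - {r}}"
  using assms(2-)
proof (induction "card (V - W)" arbitrary: W par dep rule: less_induct)
  case less
  note paths = less.prems(3) and par = less.prems(4) and edges = less.prems(5)
  have simple: "finite V" "\<And>e. e \<in> E \<Longrightarrow> e \<subseteq> V \<and> card e = 2"
    using tree by (auto simp: tree_graph_def simple_graph_def)
  show ?case
  proof (cases "W = V")
    case True
    have "{e \<in> E. e \<subseteq> V} = E" using simple by auto
    then show ?thesis using True par edges by (intro exI[of _ par] exI[of _ dep]) auto
  next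
    case False
    then obtain z where z: "z \<in> V" "z \<notin> W" using less.prems by auto
    have "paths_between V E r z \<noteq> {}"
      using tree less.prems(1,2) z by (auto simp: tree_graph_def connected_graph_def)
    then obtain q where "graph_path V E q" "hd q = r" "last q = z"
      by (auto simp: paths_between_def)
    then obtain x y where xy: "{x, y} \<in> E" "x \<in> W" "y \<notin> W"
      using successively_crossing[of "\<lambda>x y. {x, y} \<in> E" q W] less.prems(1) z
      by (auto simp: graph_path_def)
    have yV: "y \<in> V" using xy simple by blast
    \<comment> \<open>A second neighbor of \<open>y\<close> in \<open>W\<close> would close a cycle:
      a path inside \<open>W\<close> between the two neighbors avoids \<open>y\<close> and has at
      least two vertices.\<close>
    have unique: "w = x" if w: "w \<in> W" "{w, y} \<in> E" for w
    proof (rule ccontr)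
      assume "w \<noteq> x"
      obtain p where p: "graph_path W E p" "hd p = x" "last p = w" using paths xy w by blast
      have "p \<noteq> []" using p by (simp add: graph_path_def)
      have "length p \<ge> 2"
      proof (rule ccontr)
        assume "\<not> length p \<ge> 2"
        then have "\<exists>a. p = [a]" using \<open>p \<noteq> []\<close> by (cases p) (auto simp: Suc_le_eq)
        then show False using p \<open>w \<noteq> x\<close> by auto
      qed
      moreover have "graph_path V E (p @ [y])"
        using graph_path_snoc[OF p(1), of y] p w xy yV less.prems(2)
        by (auto intro: graph_path_mono)
      ultimately have "graph_cycle V E (p @ [y])"
        using p xy \<open>p \<noteq> []\<close> by (auto simp: graph_cycle_def insert_commute)
      then show False using tree by (auto simp: tree_graph_def)
    qed
    let ?W = "insert y W" and ?par = "par(y := x)" and ?dep = "dep(y := Suc (dep x))"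
    show ?thesis
    proof (rule less.hyps)
      show "card (V - ?W) < card (V - W)"
        using simple(1) yV xy by (intro psubset_card_mono) auto
      show "r \<in> ?W" "?W \<subseteq> V" using less.prems yV by auto
      show "\<exists>p. graph_path ?W E p \<and> hd p = a \<and> last p = b" if ab: "a \<in> ?W" "b \<in> ?W" for a b
      proof -
        consider "a \<in> W" "b \<in> W" | "a \<in> W" "b = y" | "a = y" "b \<in> W" | "a = y" "b = y"
          using ab by auto
        then show ?thesis
        proof cases
          case 1
          then show ?thesis using paths graph_path_mono[of W E _ ?W] by blast
        next
          case 2
          then obtain p where "graph_path W E p" "hd p = a" "last p = x" using paths xy by blast
          then show ?thesis using graph_path_snoc[of W E p y] xy 2
            by (intro exI[of _ "p @ [y]"]) (auto simp: graph_path_def)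
        next
          case 3
          then obtain p where "graph_path W E p" "hd p = x" "last p = b" using paths xy by blast
          then show ?thesis using graph_path_Cons[of W E p y] xy 3
            by (intro exI[of _ "y # p"]) (auto simp: graph_path_def)
        next
          case 4
          then show ?thesis by (intro exI[of _ "[y]"]) (auto simp: graph_path_def)
        qed
      qed
      show "?par v \<in> ?W \<and> ?dep v = Suc (?dep (?par v))" if "v \<in> ?W - {r}" for v
        using par[of v] that xy by auto
      have "{e \<in> E. e \<subseteq> ?W} = insert {y, x} {e \<in> E. e \<subseteq> W}"
      proof (intro equalityI subsetI)
        fix e assume e: "e \<in> {e \<in> E. e \<subseteq> ?W}"
        show "e \<in> insert {y, x} {e \<in> E. e \<subseteq> W}"
        proof (cases "y \<in> e")
          case True
          then obtain w where w: "e = {w, y}" "w \<noteq> y"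
            using simple(2)[of e] e by (auto simp: card_2_iff)
          then have "w = x" using e by (intro unique) auto
          then show ?thesis using w by auto
        qed (use e in auto)
      qed (use xy in \<open>auto simp: insert_commute\<close>)
      also have "\<dots> = insert {y, x} {{v, par v} |v. v \<in> W - {r}}" using edges by simp
      also have "\<dots> = {{v, ?par v} |v. v \<in> ?W - {r}}"
      proof -
        have "?W - {r} = insert y (W - {r})" using xy less.prems(1) by auto
        moreover have "(\<lambda>v. {v, ?par v}) ` (W - {r}) = (\<lambda>v. {v, par v}) ` (W - {r})"
          using xy by (intro image_cong) auto
        ultimately show ?thesis by (simp only: Setcompr_eq_image image_insert fun_upd_same)
      qed
      finally show "{e \<in> E. e \<subseteq> ?W} = {{v, ?par v} |v. v \<in> ?W - {r}}" .
    qed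
  qed
qed

text \<open>The extension starts from the single vertex \<open>r\<close>. The value
  \<open>dep r\<close> is left open; only the increase by one per generation matters, which excludes
  cycles of \<open>par\<close> and orders the top-down construction.\<close>

lemma tree_parents:
  assumes "tree_graph V E" "r \<in> V"
  obtains par and dep :: "'a \<Rightarrow> nat"
  where "\<And>v. v \<in> V - {r} \<Longrightarrow> par v \<in> V" "\<And>v. v \<in> V - {r} \<Longrightarrow> dep v = Suc (dep (par v))"
    "E = {{v, par v} |v. v \<in> V - {r}}"
proof -
  have "{e \<in> E. e \<subseteq> {r}} = {}"
  proof safe
    fix e assume "e \<in> E" "e \<subseteq> {r}"
    then have "card e = 2" "card e \<le> 1"
      using assms(1) card_mono[of "{r}" e] by (auto simp: tree_graph_def simple_graph_def)
    then show "e \<in> {}" by simp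
  qed
  moreover have "\<exists>p. graph_path {r} E p \<and> hd p = x \<and> last p = y" if "x \<in> {r}" "y \<in> {r}" for x y
    using that by (intro exI[of _ "[r]"]) (simp add: graph_path_def)
  ultimately have "\<exists>par (dep :: 'a \<Rightarrow> nat).
      (\<forall>v\<in>V - {r}. par v \<in> V \<and> dep v = Suc (dep (par v))) \<and> E = {{v, par v} |v. v \<in> V - {r}}"
    using assms(2) by (intro tree_parents_extend[OF assms(1), of r "{r}"]) auto
  then show thesis using that by blast
qed

section \<open>Distributing a palette, and a binomial estimate\<close>

text \<open>Here \<open>e\<close> maps \<open>X\<close> bijectively onto a part \<open>M\<close> of
  \<open>S\<close>. At most \<open>card X\<close> colors remain, so \<open>c\<close> can place each
  of them on an element of its own.\<close>

lemma ex_palette: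
  assumes "finite X" "finite S" "card X \<le> card S" "card S \<le> 2 * card X" "g \<notin> S"
  shows "\<exists>c e. inj_on e X \<and> e ` X \<subseteq> S \<and> c ` X \<subseteq> insert g S \<and> e ` X \<inter> c ` X = {} \<and>
    S \<subseteq> e ` X \<union> c ` X"
proof -
  obtain M where M: "M \<subseteq> S" "card M = card X" "finite M"
    using obtain_subset_with_card_n[OF assms(3)] assms(2) finite_subset by metis
  obtain e where e: "bij_betw e X M"
    using finite_same_card_bij[OF assms(1) M(3)] M(2) by metis
  have "card (S - M) \<le> card X" using M assms by (simp add: card_Diff_subset)
  then obtain h where h: "h ` (S - M) \<subseteq> X" "inj_on h (S - M)"
    using card_le_inj[of "S - M" X] assms by auto
  \<comment> \<open>The filler \<open>g\<close> goes to every element that receives no leftover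
    color.\<close>
  define c where "c x = (if x \<in> h ` (S - M) then inv_into (S - M) h x else g)" for x
  have "c x \<in> insert g (S - M)" for x
    unfolding c_def using inv_into_into[of x h "S - M"] by auto
  then have range_c: "c ` X \<subseteq> insert g (S - M)" by blast
  have onto_c: "S - M \<subseteq> c ` X"
  proof
    fix s assume s: "s \<in> S - M"
    then have "c (h s) = s" using h by (simp add: c_def)
    then show "s \<in> c ` X" using h s by (metis image_eqI image_subset_iff)
  qed
  have "inj_on e X" and im_e: "e ` X = M" using e by (auto simp: bij_betw_def)
  moreover have "e ` X \<inter> c ` X = {}"
  proof -
    have "M \<inter> insert g (S - M) = {}" using M(1) assms(5) by auto
    then show ?thesis using range_c im_e by auto
  qed
  moreover have "S \<subseteq> e ` X \<union> c ` X" using onto_c im_e by auto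
  moreover have "c ` X \<subseteq> insert g S" using range_c by auto
  moreover have "e ` X \<subseteq> S" using im_e M(1) by simp
  ultimately show ?thesis by metis
qed

text \<open>The left side is the binomial coefficient with lower index 2. The coefficients of
  \<open>2 * D - 1\<close> increase up to index \<open>D - 1\<close>, and index \<open>D\<close> has
  the same value by symmetry.\<close>

lemma choose_two_le_choose:
  fixes D m :: nat
  assumes "2 \<le> m" "m \<le> D" "3 \<le> D"
  shows "(2 * D - 1) * (D - 1) \<le> (2 * D - 1) choose m"
proof -
  have "(2 * D - 1) choose 2 = (2 * D - 1) * (D - 1)"
  proof -
    have "2 * D - 1 - 1 = 2 * (D - 1)" by simp
    then show ?thesis by (simp only: choose_two)
  qed
  moreover have "(2 * D - 1) choose 2 \<le> (2 * D - 1) choose m"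
  proof (cases "m = D")
    case True
    have "(2 * D - 1) choose m = (2 * D - 1) choose (D - 1)"
      using binomial_symmetric[of m "2 * D - 1"] True assms by (simp add: algebra_simps)
    then show ?thesis using binomial_mono[of 2 "D - 1" "2 * D - 1"] assms by simp
  next
    case False
    then show ?thesis using binomial_mono[of 2 m "2 * D - 1"] assms by simp
  qed
  ultimately show ?thesis by simp
qed

section \<open>Rooted trees and partial colorings\<close>

locale rooted_tree =
  fixes V :: "'a set" and E :: "'a set set" and r :: 'a and par :: "'a \<Rightarrow> 'a"
    and dep :: "'a \<Rightarrow> nat" and D :: nat
  assumes finite_V: "finite V" and root: "r \<in> V"
    and par_in: "v \<in> V - {r} \<Longrightarrow> par v \<in> V"
    and dep_par: "v \<in> V - {r} \<Longrightarrow> dep v = Suc (dep (par v))"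
    and edges: "E = {{v, par v} |v. v \<in> V - {r}}"
    and degree_le: "u \<in> V \<Longrightarrow> degree E u \<le> D"
    and degree_root: "3 \<le> degree E r"
begin

definition children :: "'a \<Rightarrow> 'a set" where
  "children u = {v \<in> V - {r}. par v = u}"

definition adj :: "'a \<Rightarrow> 'a \<Rightarrow> bool" where
  "adj u v \<longleftrightarrow> v \<in> children u \<or> u \<in> children v"

text \<open>The inequalities forbid immediate reversal in walks of length three, which gives the
  factors \<open>D - 1\<close> in \<open>card_near\<close>. A reversing walk has adjacent ends, so
  no pair is lost. A vertex may be near itself.\<close>

definition near :: "'a \<Rightarrow> 'a \<Rightarrow> bool" where
  "near u v \<longleftrightarrow> adj u v \<or> (\<exists>a. adj u a \<and> adj a v) \<or>
     (\<exists>a b. adj u a \<and> adj a b \<and> adj b v \<and> u \<noteq> b \<and> a \<noteq> v)"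

text \<open>A total coloring is stored as two vertex functions: \<open>c v\<close> colors \<open>v\<close>, and \<open>e v\<close> colors
  the edge from \<open>v\<close> to its parent.\<close>

definition colors :: "('a \<Rightarrow> nat) \<Rightarrow> ('a \<Rightarrow> nat) \<Rightarrow> 'a \<Rightarrow> nat set" where
  "colors c e u = insert (c u) (c ` children u \<union> e ` children u) \<union>
     (if u = r then {} else {c (par u), e u})"

text \<open>Stronger than properness: no child has the color of any edge from \<open>u\<close> to a
  child, and the color of \<open>par u\<close> does not recur below \<open>u\<close>. Both serve to
  separate leaves. A child may repeat the color \<open>e u\<close>.\<close>

definition good :: "('a \<Rightarrow> nat) \<Rightarrow> ('a \<Rightarrow> nat) \<Rightarrow> 'a \<Rightarrow> bool" where
  "good c e u \<longleftrightarrow> c u \<in> {1..2 * D + 1} \<and>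
     c ` children u \<union> e ` children u \<subseteq> {1..2 * D + 1} - {c u} \<and>
     c ` children u \<inter> e ` children u = {} \<and> inj_on e (children u) \<and>
     (u \<noteq> r \<longrightarrow> c (par u) \<notin> c ` children u \<union> e ` children u \<and> e u \<notin> e ` children u) \<and>
     (children u \<noteq> {} \<longrightarrow> 4 \<le> card (colors c e u))"

text \<open>\<open>A\<close> holds the vertices whose children are already colored, so their color
  sets are final. Pairs involving a leaf are left to \<open>good\<close>.\<close>

definition expanded :: "'a set \<Rightarrow> ('a \<Rightarrow> nat) \<Rightarrow> ('a \<Rightarrow> nat) \<Rightarrow> bool" where
  "expanded A c e \<longleftrightarrow> A \<subseteq> V \<and> r \<in> A \<and> (\<forall>x\<in>A - {r}. par x \<in> A) \<and> (\<forall>u\<in>A. good c e u) \<and>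
     (\<forall>u\<in>A. \<forall>v\<in>A. u \<noteq> v \<and> near u v \<and> children u \<noteq> {} \<and> children v \<noteq> {} \<longrightarrow>
        colors c e u \<noteq> colors c e v)"

lemma par_neq: "v \<in> V - {r} \<Longrightarrow> par v \<noteq> v"
  using dep_par[of v] by auto

lemma par_par_neq: "v \<in> V - {r} \<Longrightarrow> par v \<noteq> r \<Longrightarrow> par (par v) \<noteq> v"
  using dep_par[of v] dep_par[of "par v"] par_in[of v] by auto

lemma finite_children [simp]: "finite (children u)"
  using finite_V by (simp add: children_def)

lemma adj_iff: "{u, v} \<in> E \<longleftrightarrow> adj u v"
  unfolding edges adj_def children_def by (auto simp: doubleton_eq_iff)

lemma adj_sym: "adj u v \<longleftrightarrow> adj v u"
  by (auto simp: adj_def)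

lemma near_sym: "near u v \<Longrightarrow> near v u"
  unfolding near_def using adj_sym by metis

lemma adj_in_V: "adj u v \<Longrightarrow> u \<in> V \<and> v \<in> V"
  using par_in by (auto simp: adj_def children_def)

lemma neighbors_adj: "neighbors E u = {v. adj u v}"
  by (simp add: neighbors_def adj_iff)

lemma neighbors_eq: "u \<in> V \<Longrightarrow> neighbors E u = children u \<union> (if u = r then {} else {par u})"
  by (auto simp: neighbors_adj adj_def children_def)

lemma finite_neighbors [simp]: "finite (neighbors E u)"
  using finite_subset[OF _ finite_V, of "neighbors E u"] adj_in_V by (auto simp: neighbors_adj)

lemma card_children_root: "3 \<le> card (children r)" "card (children r) \<le> D"
  using degree_root degree_le[OF root] neighbors_eq[OF root] by (auto simp: degree_def)

lemma D_ge: "3 \<le> D"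
  using card_children_root by simp

lemma card_children_less:
  assumes "u \<in> V - {r}"
  shows "card (children u) < D"
proof -
  have "par u \<notin> children u" using par_par_neq[OF assms] by (auto simp: children_def)
  then show ?thesis using degree_le[of u] neighbors_eq[of u] assms by (simp add: degree_def)
qed

lemma card_neighbors_remove:
  assumes "adj u v"
  shows "card (neighbors E u - {v}) \<le> D - 1"
  using assms degree_le[of u] adj_in_V[OF assms] by (auto simp: neighbors_adj degree_def)

text \<open>As \<open>A\<close> is closed under parents, it contains no descendant of
  \<open>u\<close>, and a walk from \<open>u\<close> to another vertex near it in \<open>A\<close>
  passes through the parent \<open>p\<close>. This leaves \<open>p\<close>, at most
  \<open>D - 1\<close> further neighbors of \<open>p\<close>, and at most \<open>D - 1\<close>
  further neighbors of each of these.\<close>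

lemma card_near:
  assumes A: "\<And>x. x \<in> A - {r} \<Longrightarrow> par x \<in> A" "A \<subseteq> V" and u: "u \<in> V - A" "u \<noteq> r"
  shows "card {x \<in> A. near u x} \<le> D + (D - 1) * (D - 1)"
proof -
  define p where "p = par u"
  have up: "adj u p" using u by (simp add: adj_def children_def p_def)
  let ?N = "neighbors E p - {u}"
  let ?M = "\<Union>y\<in>?N. neighbors E y - {p}"
  have adj_u: "a = p \<or> par a = u \<and> a \<noteq> r \<and> a \<notin> A" if "adj u a" for a
    using that u A(1)[of a] by (auto simp: adj_def children_def p_def)
  \<comment> \<open>A walk that has descended out of \<open>A\<close> either turns back or descends
    further outside \<open>A\<close>.\<close>
  have adj_down: "b = a' \<or> par b = a \<and> b \<noteq> r \<and> b \<notin> A"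
    if "adj a b" "par a = a'" "a \<notin> A" for a b a'
    using that A(1)[of b] by (auto simp: adj_def children_def)
  have sub: "{x \<in> A. near u x} \<subseteq> insert p (?N \<union> ?M)"
  proof
    fix x assume "x \<in> {x \<in> A. near u x}"
    then have x: "x \<in> A" "near u x" "x \<noteq> u" using u by auto
    from x(2) consider "adj u x" | a where "adj u a" "adj a x"
      | a b where "adj u a" "adj a b" "adj b x" "u \<noteq> b" "a \<noteq> x"
      unfolding near_def by blast
    then show "x \<in> insert p (?N \<union> ?M)"
    proof cases
      case 1
      then show ?thesis using adj_u x by auto
    next
      case 2
      then show ?thesis using adj_u[of a] adj_down[of a x u] x by (auto simp: neighbors_adj)
    next
      case 3
      have "a = p"
      proof (rule ccontr)
        assume "a \<noteq> p"
        then have a: "par a = u" "a \<notin> A" using adj_u[of a] 3 by auto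
        then have b: "par b = a" "b \<notin> A" using adj_down[of a b u] 3 by auto
        then show False using adj_down[of b x a] 3 x by auto
      qed
      then show ?thesis using 3 by (auto simp: neighbors_adj)
    qed
  qed
  have "card ?N \<le> D - 1" using card_neighbors_remove[of p u] up adj_sym by blast
  moreover have "card ?M \<le> card ?N * (D - 1)"
  proof -
    have "card ?M \<le> (\<Sum>y\<in>?N. card (neighbors E y - {p}))" by (intro card_UN_le) simp
    also have "\<dots> \<le> (\<Sum>y\<in>?N. D - 1)"
      using card_neighbors_remove adj_sym by (intro sum_mono) (auto simp: neighbors_adj)
    finally show ?thesis by simp
  qed
  moreover have "card ?N * (D - 1) \<le> (D - 1) * (D - 1)" using calculation by simp
  moreover have "card {x \<in> A. near u x} \<le> Suc (card ?N + card ?M)"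
  proof -
    have "card {x \<in> A. near u x} \<le> card (insert p (?N \<union> ?M))"
      using sub by (intro card_mono) auto
    also have "\<dots> \<le> Suc (card (?N \<union> ?M))" by (simp add: card_insert_if)
    also have "\<dots> \<le> Suc (card ?N + card ?M)" using card_Un_le by auto
    finally show ?thesis .
  qed
  ultimately show ?thesis using D_ge by linarith
qed

text \<open>Locality: recoloring elsewhere leaves the color set of \<open>u\<close> alone, so the
  sets of treated vertices persist.\<close>

lemma colors_cong:
  assumes "\<And>y. y \<in> insert u (children u) \<Longrightarrow> c' y = c y \<and> e' y = e y"
    and "u \<noteq> r \<Longrightarrow> c' (par u) = c (par u)"
  shows "colors c' e' u = colors c e u"
proof -
  have "c' ` children u = c ` children u" "e' ` children u = e ` children u"
    using assms(1) by (auto intro!: image_cong)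
  then show ?thesis using assms by (simp add: colors_def)
qed

lemma good_cong:
  assumes "\<And>y. y \<in> insert u (children u) \<Longrightarrow> c' y = c y \<and> e' y = e y"
    and "u \<noteq> r \<Longrightarrow> c' (par u) = c (par u)"
  shows "good c' e' u \<longleftrightarrow> good c e u"
proof -
  have "c' ` children u = c ` children u" "e' ` children u = e ` children u"
    "inj_on e' (children u) \<longleftrightarrow> inj_on e (children u)"
    using assms(1) by (auto intro!: image_cong inj_on_cong)
  moreover have "colors c' e' u = colors c e u" by (intro colors_cong) (use assms in auto)
  ultimately show ?thesis using assms by (simp add: good_def)
qed

section \<open>Coloring from the root downwards\<close>

lemma expanded_root: "\<exists>c e. expanded {r} c e"
proof -
  define m where "m = card (children r)"
  have m: "3 \<le> m" "m \<le> D" using card_children_root by (auto simp: m_def)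
  \<comment> \<open>The palette has exactly \<open>m\<close> colors, so the edges at the root use
    all of it and every child gets the filler \<open>2 * D + 1\<close>. With color 1 for
    \<open>r\<close> there are at least \<open>m + 1 \<ge> 4\<close> colors.\<close>
  obtain c e where ce: "inj_on e (children r)" "e ` children r \<subseteq> {2..m + 1}"
      "c ` children r \<subseteq> insert (2 * D + 1) {2..m + 1}" "e ` children r \<inter> c ` children r = {}"
      "{2..m + 1} \<subseteq> e ` children r \<union> c ` children r"
    using ex_palette[of "children r" "{2..m + 1}" "2 * D + 1"] m by (auto simp: m_def)
  define c' where "c' = c(r := 1)"
  have r: "r \<notin> children r" by (simp add: children_def)
  have c': "c' ` children r = c ` children r" "c' r = 1" using r by (auto simp: c'_def)
  have "card {1..m + 1} \<le> card (colors c' e r)"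
  proof (intro card_mono)
    have "{1..m + 1} \<subseteq> insert 1 {2..m + 1}" by auto
    then show "{1..m + 1} \<subseteq> colors c' e r"
      using ce(5) c' by (auto simp: colors_def)
  qed (simp add: colors_def)
  then have "4 \<le> card (colors c' e r)" using m by simp
  moreover have "c ` children r \<union> e ` children r \<subseteq> {1..2 * D + 1} - {1}"
  proof -
    have "insert (2 * D + 1) {2..m + 1} \<subseteq> {1..2 * D + 1} - {1}" using m by auto
    then show ?thesis using ce(2,3) by blast
  qed
  ultimately have "good c' e r" unfolding good_def c' using ce by (simp add: Int_commute)
  then have "expanded {r} c' e" using root by (simp add: expanded_def)
  then show ?thesis by blast
qed

lemma expanded_insert:
  assumes "expanded A c e" "u \<in> V - A" "par u \<in> A"
  shows "\<exists>c e. expanded (insert u A) c e"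
proof -
  have A: "A \<subseteq> V" "r \<in> A" "\<And>x. x \<in> A - {r} \<Longrightarrow> par x \<in> A" "\<And>x. x \<in> A \<Longrightarrow> good c e x"
    and dist: "\<And>x y. x \<in> A \<Longrightarrow> y \<in> A \<Longrightarrow> x \<noteq> y \<Longrightarrow> near x y \<Longrightarrow> children x \<noteq> {} \<Longrightarrow> children y \<noteq> {}
      \<Longrightarrow> colors c e x \<noteq> colors c e y"
    using assms(1) by (auto simp: expanded_def)
  have u: "u \<in> V - {r}" "u \<noteq> r" "u \<in> children (par u)" using assms A by (auto simp: children_def)
  let ?K = "{1..2 * D + 1}"
  let ?p = "par u"
  have gp: "good c e ?p" using A(4) assms(3) by blast
  show ?thesis
  proof (cases "children u = {}")
    case True
    \<comment> \<open>A leaf has nothing below it to color; its own color is in range because its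
      parent is good.\<close>
    then have "good c e u" using gp u by (auto simp: good_def)
    then have "expanded (insert u A) c e"
      using assms A dist True unfolding expanded_def by auto
    then show ?thesis by blast
  next
    case False
    define m where "m = card (children u)"
    have m: "1 \<le> m" "m < D" using False card_children_less[OF u(1)]
      by (auto simp: m_def Suc_le_eq card_gt_0_iff)
    let ?B = "{c u, c ?p, e u}"
    have B: "c u \<noteq> c ?p" "e u \<noteq> c ?p" "c u \<noteq> e u" "?B \<subseteq> ?K"
      using gp u(3) by (auto simp: good_def)
    define R where "R = ?K - ?B"
    have finR: "finite R" by (simp add: R_def)
    have cardB: "card ?B = 3" using B(1-3) by auto
    have cardR: "card R = 2 * D - 2"
      using B(4) cardB by (simp add: R_def card_Diff_subset)
    \<comment> \<open>Both sizes fit \<open>ex_palette\<close>, as \<open>m + 1 \<le> 2 * m\<close>,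
      and Pascal's rule merges the two counts into one binomial coefficient.\<close>
    define F where "F = {S. S \<subseteq> R \<and> card S = m} \<union> {S. S \<subseteq> R \<and> card S = Suc m}"
    have "card F = (card R choose m) + (card R choose Suc m)"
      unfolding F_def using finR
      by (subst card_Un_disjoint) (auto simp: n_subsets)
    also have "\<dots> = (2 * D - 1) choose Suc m"
    proof -
      have "2 * D - 1 = Suc (2 * D - 2)" using D_ge by simp
      then show ?thesis using cardR by simp
    qed
    finally have cardF: "(2 * D - 1) * (D - 1) \<le> card F"
      using choose_two_le_choose[of "Suc m" D] m D_ge by simp
    let ?bad = "colors c e ` {x \<in> A. near u x}"
    have finA: "finite A" using A(1) finite_V finite_subset by blast
    have "card ?bad \<le> D + (D - 1) * (D - 1)"
      using card_near[of A u] A u(2) assms(2) card_image_le[of "{x \<in> A. near u x}" "colors c e"] finA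
      by fastforce
    \<comment> \<open>The difference of the two sides is \<open>D * (D - 2)\<close>; writing
      \<open>D = k + 3\<close> removes the truncated subtractions.\<close>
    also have "\<dots> < (2 * D - 1) * (D - 1)"
    proof -
      obtain k where "D = k + 3" using D_ge by (metis add.commute le_Suc_ex)
      then show ?thesis by (simp add: algebra_simps)
    qed
    also have "\<dots> \<le> card F" by (fact cardF)
    also have "\<dots> = card ((\<union>) ?B ` F)"
    proof (rule card_image[symmetric])
      \<comment> \<open>Members of \<open>F\<close> avoid \<open>?B\<close>, so different palettes
        give different color sets.\<close>
      show "inj_on ((\<union>) ?B) F"
      proof (rule inj_onI)
        fix S T assume "S \<in> F" "T \<in> F" and eq: "?B \<union> S = ?B \<union> T"
        then have "S \<inter> ?B = {}" "T \<inter> ?B = {}" by (auto simp: F_def R_def)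
        then show "S = T" using eq by blast
      qed
    qed
    finally have "card ?bad < card ((\<union>) ?B ` F)" .
    then have "\<not> (\<union>) ?B ` F \<subseteq> ?bad"
      using card_mono[of ?bad "(\<union>) ?B ` F"] finA by auto
    then obtain S where S: "S \<in> F" "?B \<union> S \<notin> ?bad" by blast
    have S': "S \<subseteq> R" "finite S" "m \<le> card S" "card S \<le> 2 * m"
      using S(1) m finite_subset[OF _ finR] by (auto simp: F_def)
    have SB: "S \<inter> ?B = {}" "S \<subseteq> ?K" using S'(1) by (auto simp: R_def)
    \<comment> \<open>The filler is the color of the edge above \<open>u\<close>: it belongs to the
      color set of \<open>u\<close> anyway, and no child of \<open>u\<close> lies on that
      edge.\<close>
    obtain cn en where n: "inj_on en (children u)" "en ` children u \<subseteq> S"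
      "cn ` children u \<subseteq> insert (e u) S" "en ` children u \<inter> cn ` children u = {}"
      "S \<subseteq> en ` children u \<union> cn ` children u"
      using ex_palette[of "children u" S "e u"] S' SB by (auto simp: m_def)
    define c' where "c' x = (if x \<in> children u then cn x else c x)" for x
    define e' where "e' x = (if x \<in> children u then en x else e x)" for x
    \<comment> \<open>The recolored vertices lie outside \<open>A\<close> and are not children of
      vertices of \<open>A\<close>, so nothing seen from \<open>A\<close> changes.\<close>
    have fresh: "x \<notin> children u" if "x \<in> A" for x
      using that A(3)[of x] assms(2) by (auto simp: children_def)
    have disj: "y \<notin> children u" if "y \<in> children x" "x \<in> A" for x y
      using that assms(2) by (auto simp: children_def)
    have uu: "u \<notin> children u" using par_neq[OF u(1)] by (auto simp: children_def)
    have img: "c' ` children u = cn ` children u" "e' ` children u = en ` children u"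
      by (auto simp: c'_def e'_def)
    have inj: "inj_on e' (children u)" using n(1) by (simp add: e'_def inj_on_def)
    have old: "c' u = c u" "e' u = e u" "c' ?p = c ?p"
      using uu fresh[OF assms(3)] by (auto simp: c'_def e'_def)
    have agree: "c' y = c y \<and> e' y = e y" if "y \<in> insert x (children x)" "x \<in> A" for x y
      using that fresh[of x] disj[of y x] by (auto simp: c'_def e'_def)
    have agree_par: "c' (par x) = c (par x)" if "x \<in> A" "x \<noteq> r" for x
      using that fresh[of "par x"] A(3)[of x] by (auto simp: c'_def)
    have goodA: "good c' e' x" if "x \<in> A" for x
      using good_cong[of x c' c e' e] agree[of _ x] agree_par[of x] that A(4) by blast
    have colA: "colors c' e' x = colors c e x" if "x \<in> A" for x
      using colors_cong[of x c' c e' e] agree[of _ x] agree_par[of x] that by blast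
    have colu: "colors c' e' u = ?B \<union> S"
    proof -
      have "colors c' e' u = ?B \<union> (cn ` children u \<union> en ` children u)"
        unfolding colors_def img old using u(2) by auto
      also have "\<dots> = ?B \<union> S" using n(2,3,5) by blast
      finally show ?thesis .
    qed
    have goodu: "good c' e' u"
    proof -
      have "4 \<le> card (?B \<union> S)"
        using card_Un_disjoint[of ?B S] SB(1) S' cardB m by (simp add: Int_commute)
      moreover have "cn ` children u \<union> en ` children u \<subseteq> insert (e u) S" using n(2,3) by blast
      moreover have "c u \<notin> insert (e u) S" "c ?p \<notin> insert (e u) S" "insert (e u) S \<subseteq> ?K" "e u \<notin> S"
        "c u \<in> ?K"
        using B SB by auto
      moreover have "cn ` children u \<inter> en ` children u = {}" using n(4) by blast
      ultimately show ?thesis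
        unfolding good_def colu img old using inj n(2) by blast
    qed
    have new: "colors c' e' u \<noteq> colors c' e' x" if "x \<in> A" "near u x" for x
      using S(2) that colA colu by auto
    have "expanded (insert u A) c' e'"
      unfolding expanded_def
    proof (intro conjI ballI impI)
      fix x y assume xy: "x \<in> insert u A" "y \<in> insert u A"
        "x \<noteq> y \<and> near x y \<and> children x \<noteq> {} \<and> children y \<noteq> {}"
      then consider "x \<in> A" "y \<in> A" | "x = u" "y \<in> A" | "x \<in> A" "y = u" by auto
      then show "colors c' e' x \<noteq> colors c' e' y"
      proof cases
        case 1
        then show ?thesis using dist colA xy(3) by metis
      next
        case 2
        then show ?thesis using new xy(3) by metis
      next
        case 3
        then show ?thesis using new near_sym xy(3) by metis
      qed
    qed (use A u assms(3) goodA goodu in auto)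
    then show ?thesis by blast
  qed
qed

text \<open>An untreated vertex of least depth has a treated parent, so
  \<open>expanded_insert\<close> applies until \<open>A\<close> is all of \<open>V\<close>.\<close>

lemma expanded_extend:
  assumes "expanded A c e"
  shows "\<exists>c e. expanded V c e"
  using assms
proof (induction "card (V - A)" arbitrary: A c e rule: less_induct)
  case less
  show ?case
  proof (cases "A = V")
    case False
    have A: "A \<subseteq> V" "r \<in> A" using less.prems by (auto simp: expanded_def)
    then obtain u where u: "u \<in> V - A" "\<And>v. v \<in> V - A \<Longrightarrow> dep u \<le> dep v"
      using False ex_has_least_nat[of "\<lambda>v. v \<in> V - A" _ dep] by blast
    have "par u \<in> A"
    proof (rule ccontr)
      assume "par u \<notin> A"
      moreover have "u \<in> V - {r}" using u A by auto
      ultimately show False using u(2)[of "par u"] par_in[of u] dep_par[of u] by auto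
    qed
    then obtain c' e' where "expanded (insert u A) c' e'"
      using expanded_insert[OF less.prems u(1)] by blast
    moreover have "card (V - insert u A) < card (V - A)"
      using u(1) finite_V by (intro psubset_card_mono) auto
    ultimately show ?thesis using less.hyps by blast
  qed (use less.prems in blast)
qed

section \<open>From vertex functions to a total coloring\<close>

definition lower_end :: "'a set \<Rightarrow> 'a" where
  "lower_end d = (THE v. v \<in> V - {r} \<and> d = {v, par v})"

text \<open>A second candidate would make two vertices each other's parent, against the
  depths.\<close>

lemma lower_end_eq [simp]:
  assumes "v \<in> V - {r}"
  shows "lower_end {v, par v} = v"
  unfolding lower_end_def
proof (rule the_equality)
  fix w assume w: "w \<in> V - {r} \<and> {v, par v} = {w, par w}"
  show "w = v"
  proof (rule ccontr)
    assume "w \<noteq> v"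
    then have "w = par v" "v = par w" using w by (auto simp: doubleton_eq_iff)
    then show False using par_par_neq[OF assms] w by auto
  qed
qed (use assms in auto)

definition coloring :: "('a \<Rightarrow> nat) \<Rightarrow> ('a \<Rightarrow> nat) \<Rightarrow> 'a + 'a set \<Rightarrow> nat" where
  "coloring c e = case_sum c (\<lambda>d. e (lower_end d))"

lemma coloring_simps [simp]:
  "coloring c e (Inl v) = c v"
  "v \<in> V - {r} \<Longrightarrow> coloring c e (Inr {v, par v}) = e v"
  by (auto simp: coloring_def)

lemma color_set_eq:
  assumes "u \<in> V"
  shows "color_set E (coloring c e) u = colors c e u"
proof -
  let ?f = "coloring c e"
  have down: "?f (Inr {u, v}) = e v" if "v \<in> children u" for v
    using that coloring_simps(2)[of v c e] by (auto simp: children_def insert_commute)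
  have "(\<lambda>v. ?f (Inr {u, v})) ` children u = e ` children u"
    using down by (intro image_cong) auto
  moreover have "color_set E ?f u =
      insert (c u) (c ` neighbors E u) \<union> (\<lambda>v. ?f (Inr {u, v})) ` neighbors E u"
    by (auto simp: color_set_def total_neighborhood_def closed_neighbors_def image_Un image_image
        Setcompr_eq_image)
  ultimately show ?thesis
    using assms neighbors_eq[OF assms] by (auto simp: colors_def image_Un)
qed

text \<open>If all paths had at least five vertices, the infimum would be at least 4. On a path with
  at most four vertices, distinctness supplies the inequalities in \<open>near\<close>.\<close>

lemma near_if_graph_dist:
  assumes "graph_dist V E u v \<le> 3" "u \<noteq> v"
  shows "near u v"
proof -
  have "\<exists>p\<in>paths_between V E u v. length p \<le> 4"
  proof (rule ccontr)
    assume *: "\<not> ?thesis"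
    have "4 \<le> graph_dist V E u v"
      unfolding graph_dist_def
    proof (rule INF_greatest)
      fix p assume "p \<in> paths_between V E u v"
      then have "4 \<le> length p - 1" using * by force
      then show "4 \<le> enat (length p - 1)" by (simp add: numeral_eq_enat)
    qed
    then have "(4 :: enat) \<le> 3" using assms(1) order_trans by blast
    then show False by (simp add: numeral_eq_enat)
  qed
  then obtain p where p: "graph_path V E p" "hd p = u" "last p = v" "length p \<le> 4"
    by (auto simp: paths_between_def)
  have "length p \<noteq> 0" using p by (simp add: graph_path_def)
  then have "length p = 1 \<or> length p = 2 \<or> length p = 3 \<or> length p = 4" using p(4) by arith
  then consider a where "p = [a]" | a b where "p = [a, b]" | a b d where "p = [a, b, d]"
    | a b d g where "p = [a, b, d, g]"
    by (auto simp: length_Suc_conv eval_nat_numeral)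
  then show ?thesis using p assms(2)
    by cases (auto simp: graph_path_def near_def adj_iff)
qed

section \<open>Properness and distinct color sets\<close>

context
  fixes c e
  assumes ex: "expanded V c e"
begin

lemma good_V: "u \<in> V \<Longrightarrow> good c e u"
  using ex by (simp add: expanded_def)

lemma good_child:
  assumes "v \<in> V - {r}"
  shows "c v \<in> {1..2 * D + 1}" "e v \<in> {1..2 * D + 1}" "c v \<noteq> c (par v)" "e v \<noteq> c (par v)"
    "e v \<noteq> c v"
    "par v \<noteq> r \<Longrightarrow> c (par (par v)) \<noteq> c v \<and> c (par (par v)) \<noteq> e v \<and> e (par v) \<noteq> e v"
proof -
  let ?p = "par v"
  have v: "v \<in> children ?p" using assms by (simp add: children_def)
  have "good c e ?p" using good_V[OF par_in[OF assms]] .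
  then have "c ` children ?p \<union> e ` children ?p \<subseteq> {1..2 * D + 1} - {c ?p}"
    and disj: "c ` children ?p \<inter> e ` children ?p = {}"
    and above: "?p \<noteq> r \<longrightarrow> c (par ?p) \<notin> c ` children ?p \<union> e ` children ?p \<and> e ?p \<notin> e ` children ?p"
    unfolding good_def by metis+
  then have "c v \<in> {1..2 * D + 1} - {c ?p}" "e v \<in> {1..2 * D + 1} - {c ?p}"
    using v by (meson UnI1 UnI2 imageI subsetD)+
  then show "c v \<in> {1..2 * D + 1}" "e v \<in> {1..2 * D + 1}" "c v \<noteq> c ?p" "e v \<noteq> c ?p"
    by simp_all
  show "e v \<noteq> c v" using disj v by (metis disjoint_iff imageI)
  show "c (par ?p) \<noteq> c v \<and> c (par ?p) \<noteq> e v \<and> e ?p \<noteq> e v" if "?p \<noteq> r"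
    using above that v by (metis UnI1 UnI2 imageI)
qed

lemma good_siblings:
  assumes "v \<in> V - {r}" "w \<in> V - {r}" "par v = par w"
  shows "e v \<noteq> c w" "e v = e w \<Longrightarrow> v = w"
proof -
  have *: "v \<in> children (par v)" "w \<in> children (par v)" using assms by (simp_all add: children_def)
  have "good c e (par v)" using good_V[OF par_in[OF assms(1)]] .
  then have "c ` children (par v) \<inter> e ` children (par v) = {}" "inj_on e (children (par v))"
    unfolding good_def by metis+
  then show "e v \<noteq> c w" "e v = e w \<Longrightarrow> v = w"
    using * by (metis disjoint_iff imageI) (metis \<open>inj_on e (children (par v))\<close> * inj_onD)
qed

lemma proper_coloring: "proper_total_coloring V E (2 * D + 1) (coloring c e)"
proof -
  have "coloring c e ` (Inl ` V \<union> Inr ` E) \<subseteq> {1..2 * D + 1}"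
  proof -
    have "c v \<in> {1..2 * D + 1}" if "v \<in> V" for v using good_V[OF that] by (simp add: good_def)
    then show ?thesis using good_child(2) by (auto simp: edges simp del: atLeastAtMost_iff)
  qed
  moreover have "c u \<noteq> c v" if "{u, v} \<in> E" for u v
    using that good_child(3) unfolding adj_iff adj_def children_def by fastforce
  moreover have "coloring c e (Inr d) \<noteq> coloring c e (Inr d')"
    if d: "d \<in> E" "d' \<in> E" "d \<noteq> d'" "d \<inter> d' \<noteq> {}" for d d'
  proof -
    obtain v w where v: "v \<in> V - {r}" "d = {v, par v}" and w: "w \<in> V - {r}" "d' = {w, par w}"
      using d edges by auto
    then have "v \<noteq> w" using d by auto
    \<comment> \<open>Edges with a common endpoint are consecutive on a descending path or lead to
      siblings.\<close>
    then consider "par w = v" | "par v = w" | "par v = par w" using d v w by auto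
    then have "e v \<noteq> e w"
    proof cases
      case 1
      then show ?thesis using good_child(6)[OF w(1)] v(1) by auto
    next
      case 2
      then show ?thesis using good_child(6)[OF v(1)] w(1) by auto
    next
      case 3
      then show ?thesis using good_siblings(2)[OF v(1) w(1)] \<open>v \<noteq> w\<close> by blast
    qed
    then show ?thesis using v w by simp
  qed
  moreover have "c v \<noteq> coloring c e (Inr d)" if d: "d \<in> E" "v \<in> d" for d v
  proof -
    obtain w where w: "w \<in> V - {r}" "d = {w, par w}" using d edges by auto
    then show ?thesis using d good_child(4,5)[OF w(1)] by auto
  qed
  ultimately show ?thesis by (simp add: proper_total_coloring_def)
qed

lemma colors_leaf:
  assumes "children v = {}" "v \<in> V"
  shows "v \<in> V - {r}" "colors c e v = {c v, c (par v), e v}"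
proof -
  have "v \<noteq> r" using assms(1) card_children_root(1) by fastforce
  then show "v \<in> V - {r}" "colors c e v = {c v, c (par v), e v}"
    using assms by (auto simp: colors_def)
qed

lemma card_colors_leaf:
  assumes "children v = {}" "v \<in> V"
  shows "card (colors c e v) < 4"
  using colors_leaf(2)[OF assms] card_length[of "[c v, c (par v), e v]"] by simp

text \<open>At distance 3 the parent of one leaf is the grandparent of the other, whose color is
  missing around the latter.\<close>

lemma colors_leaf_leaf:
  assumes leaf: "children u = {}" "children v = {}" and "u \<in> V" "v \<in> V" "u \<noteq> v" "near u v"
  shows "colors c e u \<noteq> colors c e v"
proof
  assume eq: "colors c e u = colors c e v"
  note u = colors_leaf[OF leaf(1) \<open>u \<in> V\<close>] and v = colors_leaf[OF leaf(2) \<open>v \<in> V\<close>]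
  have adj_leaf: "adj x a \<longleftrightarrow> a = par x" if "children x = {}" "x \<in> V - {r}" for x a
    using that by (auto simp: adj_def children_def)
  have far: "colors c e x \<noteq> colors c e y"
    if "children x = {}" "x \<in> V" "children y = {}" "y \<in> V" "par x \<noteq> r" "par y = par (par x)" for x y
  proof -
    note x = colors_leaf[OF that(1,2)]
    have "par x \<in> V - {r}" using par_in[OF x(1)] that(5) by simp
    then have "c (par y) \<notin> colors c e x"
      unfolding x(2) that(6) using good_child(3)[of "par x"] good_child(6)[OF x(1) that(5)] by simp
    moreover have "c (par y) \<in> colors c e y" using colors_leaf[OF that(3,4)] by simp
    ultimately show ?thesis by metis
  qed
  have "\<not> adj u v" using leaf by (auto simp: adj_def)
  \<comment> \<open>A leaf is adjacent only to its parent, so a walk between the leaves runs through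
    both parents.\<close>
  then consider "par u = par v" | "adj (par u) (par v)"
  proof -
    have "a = par u" if "adj u a" for a using that adj_leaf[OF leaf(1) u(1)] by simp
    moreover have "b = par v" if "adj b v" for b
      using that adj_leaf[OF leaf(2) v(1)] adj_sym[of b v] by simp
    ultimately show ?thesis using that \<open>near u v\<close> \<open>\<not> adj u v\<close> unfolding near_def by blast
  qed
  then show False
  proof cases
    case 1
    \<comment> \<open>For siblings the color \<open>e u\<close> is missing around \<open>v\<close>:
      it differs from \<open>c v\<close>, from the color of the common parent and from
      \<open>e v\<close>.\<close>
    have "e u \<in> {c v, c (par v), e v}" using eq u(2) v(2) by blast
    then have "e u \<in> {c v, c (par u), e v}" using 1 by simp
    then show False
      using good_siblings[OF u(1) v(1) 1] good_child(4)[OF u(1)] \<open>u \<noteq> v\<close> by blast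
  next
    case 2
    then have "par u \<noteq> r \<and> par v = par (par u) \<or> par v \<noteq> r \<and> par u = par (par v)"
      by (auto simp: adj_def children_def)
    then show False
      using far[of u v] far[of v u] leaf eq \<open>u \<in> V\<close> \<open>v \<in> V\<close> by auto
  qed
qed

lemma D3_coloring: "D3_VSDTC V E (2 * D + 1) (coloring c e)"
proof -
  have "colors c e u \<noteq> colors c e v"
    if uv: "u \<in> V" "v \<in> V" "u \<noteq> v" "graph_dist V E u v \<le> 3" for u v
  proof -
    have "near u v" using near_if_graph_dist uv by blast
    have inner: "4 \<le> card (colors c e x)" if "x \<in> V" "children x \<noteq> {}" for x
      using good_V that by (simp add: good_def)
    consider "children u = {}" "children v = {}" | "children u = {}" "children v \<noteq> {}"
      | "children u \<noteq> {}" "children v = {}" | "children u \<noteq> {}" "children v \<noteq> {}" by blast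
    then show ?thesis
    proof cases
      case 1
      then show ?thesis using colors_leaf_leaf uv \<open>near u v\<close> by blast
    next
      case 2
      then show ?thesis using card_colors_leaf[of u] inner[of v] uv by auto
    next
      case 3
      then show ?thesis using card_colors_leaf[of v] inner[of u] uv by auto
    next
      case 4
      then show ?thesis using ex uv \<open>near u v\<close> by (simp add: expanded_def)
    qed
  qed
  then show ?thesis using proper_coloring color_set_eq by (simp add: D3_VSDTC_def)
qed

end

lemma chi_le: "chi_3vsdt V E \<le> enat (2 * D + 1)"
proof -
  obtain c0 e0 where "expanded {r} c0 e0" using expanded_root by blast
  then obtain c e where "expanded V c e" using expanded_extend by blast
  then have "D3_VSDTC V E (2 * D + 1) (coloring c e)" by (rule D3_coloring)
  then show ?thesis unfolding chi_3vsdt_def by (intro INF_lower) blast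
qed

end

theorem corollary1p13:
  fixes V :: "'a set" and E :: "'a set set"
  assumes "tree_graph V E"
    and "max_degree V E \<ge> 3"
  shows "chi_3vsdt V E \<le> enat (2 * max_degree V E + 1)"
proof -
  have V: "finite V" "V \<noteq> {}"
    using assms(1) by (auto simp: tree_graph_def simple_graph_def connected_graph_def)
  then have "max_degree V E \<in> degree E ` V" unfolding max_degree_def by (intro Max_in) auto
  \<comment> \<open>With this root the hypothesis gives at least three children of \<open>r\<close>,
    hence four colors around it.\<close>
  then obtain r where r: "r \<in> V" "max_degree V E = degree E r" by blast
  obtain par and dep :: "'a \<Rightarrow> nat" where
    "\<And>v. v \<in> V - {r} \<Longrightarrow> par v \<in> V" "\<And>v. v \<in> V - {r} \<Longrightarrow> dep v = Suc (dep (par v))"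
    "E = {{v, par v} |v. v \<in> V - {r}}"
    using tree_parents[OF assms(1) r(1)] by blast
  moreover have "degree E u \<le> max_degree V E" if "u \<in> V" for u
    unfolding max_degree_def using V that by (intro Max_ge) auto
  ultimately interpret rooted_tree V E r par dep "max_degree V E"
    using V r assms(2) by unfold_locales auto
  show ?thesis by (rule chi_le)
qed

end
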